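(* Let $\mathcal{C}_1\subseteq\mathbb{F}_{q^m}^n$ be a linear code, $\mathcal{C}_2\subsetneqq\mathcal{C}_1$ a subcode with $\dim\mathcal{C}_2=\dim\mathcal{C}_1-l$, $l\ge 1$, and $\psi:\mathbb{F}_{q^m}^l\to\mathcal{C}_1/\mathcal{C}_2$ a linear bijection. Let $t\ge0$, $0\le\rho\le n$, and $N\ge n-\rho$ be integers. Then the nested coset coding scheme $(\mathcal{C}_1,\mathcal{C}_2,\psi)$ is universally $t$-error-$\rho$-erasure-correcting (in the coherent setting, i.e. with the transfer matrix known to the receiver) if and only if $M_{R,1}(\mathcal{C}_1,\mathcal{C}_2)>2t+\rho$.
   Context: $\mathbb{F}_{q^m}$ is the degree-$m$ extension ($m\ge1$) of the finite field $\mathbb{F}_q$. Linear codes are $\mathbb{F}_{q^m}$-subspaces of the row space $\mathbb{F}_{q^m}^n$; dimensions are over $\mathbb{F}_{q^m}$. For a subspace $V\subseteq\mathbb{F}_{q^m}^n$ put $V^q=\{[v_1^q,\dots,v_n^q]: v\in V\}$, and let $\Gamma(\mathbb{F}_{q^m}^n)$ be the set of $\mathbb{F}_{q^m}$-subspaces $V\subseteq\mathbb{F}_{q^m}^n$ with $V=V^q$. The first relative generalized rank weight is $M_{R,1}(\mathcal{C}_1,\mathcal{C}_2)=\min\{\dim V: V\in\Gamma(\mathbb{F}_{q^m}^n),\ \dim(\mathcal{C}_1\cap V)-\dim(\mathcal{C}_2\cap V)\ge 1\}$. A message $S\in\mathbb{F}_{q^m}^l$ is encoded as some $X\in\psi(S)$;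 the sink receives $Y\in\mathbb{F}_{q^m}^N$ with $Y^{\rm T}=AX^{\rm T}+DZ^{\rm T}$, where $A\in\mathbb{F}_q^{N\times n}$ is the transfer matrix, $Z\in\mathbb{F}_{q^m}^t$ are $t$ error packets, and $D\in\mathbb{F}_q^{N\times t}$. Universally $t$-error-$\rho$-erasure-correcting in the coherent setting means: for every $A\in\mathbb{F}_q^{N\times n}$ with $\operatorname{rank}A\ge n-\rho$, the message $S$ is uniquely determined by $Y$ (given $A$), for all $X\in\psi(S)$, $D\in\mathbb{F}_q^{N\times t}$, $Z\in\mathbb{F}_{q^m}^t$; that is, there are no $S\ne S'$ in $\mathbb{F}_{q^m}^l$, $X\in\psi(S)$, $X'\in\psi(S')$, $D,D'\in\mathbb{F}_q^{N\times t}$, $Z,Z'\in\mathbb{F}_{q^m}^t$ with $AX^{\rm T}+DZ^{\rm T}=AX'^{\rm T}+D'Z'^{\rm T}$. *)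

theory Defs
  imports "Jordan_Normal_Form.DL_Rank" "HOL-Algebra.AbelCoset"
begin

definition vdim :: "nat \<Rightarrow> 'a::field vec set \<Rightarrow> nat" where
  "vdim n U = vectorspace.dim class_ring ((module_vec TYPE('a) n)\<lparr>carrier := U\<rparr>)"

definition linear_code :: "nat \<Rightarrow> 'a::field vec set \<Rightarrow> bool" where
  "linear_code n C \<longleftrightarrow> VectorSpace.subspace class_ring C (module_vec TYPE('a) n)"

(* C1/C2 with carrier the cosets C2 + x, x in C1.  Scalar multiplication adds C2 once more so that the
   case c = 0 also gives the coset C2 and not just {0}. *)
definition quotient_space ::
  "nat \<Rightarrow> 'a::field vec set \<Rightarrow> 'a vec set \<Rightarrow> ('a, 'a vec set) module" where
  "quotient_space n C1 C2 =
    \<lparr> carrier = A_RCOSETS ((module_vec TYPE('a) n)\<lparr>carrier := C1\<rparr>) C2,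
      mult = undefined,
      one = undefined,
      zero = C2,
      add = set_add (module_vec TYPE('a) n),
      smult = (\<lambda>c U. set_add (module_vec TYPE('a) n) C2 ((\<lambda>u. c \<cdot>\<^sub>v u) ` U)) \<rparr>"

definition linear_bijection ::
  "nat \<Rightarrow> nat \<Rightarrow> 'a::field vec set \<Rightarrow> 'a vec set \<Rightarrow> ('a vec \<Rightarrow> 'a vec set) \<Rightarrow> bool" where
  "linear_bijection l n C1 C2 \<psi> \<longleftrightarrow>
    \<psi> \<in> LinearCombinations.module_hom class_ring (module_vec TYPE('a) l) (quotient_space n C1 C2) \<and>
    bij_betw \<psi> (carrier_vec l) (carrier (quotient_space n C1 C2))"

(* 'f is F_q and 'a is F_{q^m}; the inclusion of F_q into its degree-m extension is the
   homomorphism emb, and m is the dimension of 'a as a vector space over 'f. *)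
definition field_extension_of_degree ::
  "('f::field \<Rightarrow> 'a::field) \<Rightarrow> nat \<Rightarrow> bool" where
  "field_extension_of_degree emb m \<longleftrightarrow>
    field_hom emb \<and> vector_space.dim (\<lambda>c x. emb c * x) (UNIV :: 'a set) = m"

definition frobenius_image :: "nat \<Rightarrow> 'a::field vec set \<Rightarrow> 'a vec set" where
  "frobenius_image q V = map_vec (\<lambda>x. x ^ q) ` V"

definition Gamma_spaces :: "nat \<Rightarrow> nat \<Rightarrow> 'a::field vec set set" where
  "Gamma_spaces q n = {V. linear_code n V \<and> V = frobenius_image q V}"

(* The set is finite, and it is nonempty whenever dim C2 < dim C1 (take V to be the whole space),
   so Min is a genuine minimum there. *)
definition M_R1 :: "nat \<Rightarrow> nat \<Rightarrow> 'a::field vec set \<Rightarrow> 'a vec set \<Rightarrow> nat" where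
  "M_R1 q n C1 C2 =
    Min {vdim n V | V. V \<in> Gamma_spaces q n \<and>
                       int (vdim n (C1 \<inter> V)) - int (vdim n (C2 \<inter> V)) \<ge> 1}"

(* Matrices over F_q act on vectors over F_{q^m} through emb; the rank of A is taken over F_q.
   Vectors carry no orientation, so A X^T + D Z^T is written with *\<^sub>v. *)
definition universally_correcting ::
  "('f::field \<Rightarrow> 'a::field) \<Rightarrow> nat \<Rightarrow> nat \<Rightarrow> nat \<Rightarrow> ('a vec \<Rightarrow> 'a vec set) \<Rightarrow> nat \<Rightarrow> nat \<Rightarrow> bool"
  where
  "universally_correcting emb N n l \<psi> t \<rho> \<longleftrightarrow>
    (\<forall>A \<in> carrier_mat N n. vec_space.rank N A \<ge> n - \<rho> \<longrightarrow>
      \<not> (\<exists>S \<in> carrier_vec l. \<exists>S' \<in> carrier_vec l. S \<noteq> S' \<and>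
          (\<exists>X \<in> \<psi> S. \<exists>X' \<in> \<psi> S'.
           \<exists>D \<in> carrier_mat N t. \<exists>D' \<in> carrier_mat N t.
           \<exists>Z \<in> carrier_vec t. \<exists>Z' \<in> carrier_vec t.
             map_mat emb A *\<^sub>v X + map_mat emb D *\<^sub>v Z =
             map_mat emb A *\<^sub>v X' + map_mat emb D' *\<^sub>v Z')))"

end

theory Submission
  imports Defs "HOL-Library.Cardinality" "Jordan_Normal_Form.Matrix_Kernel"
begin

text \<open>
  Two messages can be confused exactly when some \<open>w \<in> C1 - C2\<close> satisfies \<open>A w = D Z + D' Z'\<close> with
  \<open>A\<close>, \<open>D\<close>, \<open>D'\<close> over \<open>F_q\<close>. For a given \<open>A\<close> the space of all \<open>w\<close> with \<open>A w\<close> in the column space of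
  \<open>D\<close> and \<open>D'\<close> is Frobenius stable, and its dimension is at most \<open>2 t + dim (ker A) \<le> 2 t + \<rho>\<close>.
  Conversely, a Frobenius stable \<open>V\<close> has a basis over \<open>F_q\<close> (Galois descent). If \<open>dim V \<le> 2 t + \<rho>\<close>,
  choose \<open>A\<close> of rank at least \<open>n - \<rho>\<close> that annihilates \<open>\<rho>\<close> of the basis vectors; then \<open>A w\<close> for
  \<open>w \<in> V\<close> is a combination of \<open>2 t\<close> vectors over \<open>F_q\<close>.
  As all fields are finite, dimensions are compared by counting: \<open>card U = CARD('a) ^ dim U\<close>.
\<close>

section \<open>Counting in linear codes\<close>

lemma finite_carrier_vec: "finite (carrier_vec n :: 'a::finite vec set)"
proof (rule finite_subset)
  show "carrier_vec n \<subseteq> vec n ` ({..<n} \<rightarrow>\<^sub>E (UNIV :: 'a set))"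
  proof
    fix v :: "'a vec" assume "v \<in> carrier_vec n"
    then have v: "v = vec n (restrict (($) v) {..<n})" by (intro eq_vecI) simp_all
    show "v \<in> vec n ` ({..<n} \<rightarrow>\<^sub>E UNIV)"
      by (subst v, rule imageI) (auto split: if_splits)
  qed
  show "finite (vec n ` ({..<n} \<rightarrow>\<^sub>E (UNIV :: 'a set)))"
    by (intro finite_imageI finite_PiE) simp_all
qed

lemma linear_code_iff:
  fixes U :: "'a::field vec set"
  shows "linear_code n U \<longleftrightarrow> U \<subseteq> carrier_vec n \<and> 0\<^sub>v n \<in> U \<and> (\<forall>u\<in>U. \<forall>v\<in>U. u + v \<in> U) \<and>
    (\<forall>c. \<forall>u\<in>U. c \<cdot>\<^sub>v u \<in> U)"
  using vec_vs[where ?'a='a and n=n] vec_module[where ?'a='a and n=n]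
  by (simp add: linear_code_def VectorSpace.subspace_def submodule_def module_vec_simps
      class_ring_simps Ball_def) blast

lemma linear_codeD:
  assumes "linear_code n U"
  shows "U \<subseteq> carrier_vec n" "0\<^sub>v n \<in> U" "u \<in> U \<Longrightarrow> v \<in> U \<Longrightarrow> u + v \<in> U"
    "u \<in> U \<Longrightarrow> c \<cdot>\<^sub>v u \<in> U" "u \<in> U \<Longrightarrow> u \<in> carrier_vec n"
  using assms unfolding linear_code_iff by blast+

lemma linear_code_diff:
  assumes "linear_code n U" "u \<in> U" "v \<in> U"
  shows "u - v \<in> U"
proof -
  have "u - v = u + (-1) \<cdot>\<^sub>v v"
    using linear_codeD(5)[OF assms(1)] assms(2,3) by auto
  then show ?thesis using linear_codeD(3,4)[OF assms(1)] assms(2,3) by metis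
qed

lemma linear_code_finite:
  fixes U :: "'a::{field,finite} vec set"
  shows "linear_code n U \<Longrightarrow> finite U"
  using finite_subset[OF linear_codeD(1) finite_carrier_vec] .

lemma linear_code_carrier: "linear_code n (carrier_vec n)"
  unfolding linear_code_iff by auto

lemma linear_code_Int:
  "linear_code n U \<Longrightarrow> linear_code n V \<Longrightarrow> linear_code n (U \<inter> V)"
  unfolding linear_code_iff by auto

lemma card_field_gt_1: "1 < CARD('a::{field,finite})"
  using card_mono[of "UNIV :: 'a set" "{0, 1}"] by simp

text \<open>Coordinates with respect to a basis identify \<open>U\<close> with the functions from
  that basis to the field. All later comparisons of dimensions go through this count.\<close>

lemma card_linear_code:
  fixes U :: "'a::{field,finite} vec set"
  assumes "linear_code n U"
  shows "card U = CARD('a) ^ vdim n U"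
proof -
  let ?M = "(module_vec TYPE('a) n)\<lparr>carrier := U\<rparr>"
  interpret W: vectorspace class_ring ?M
    using vectorspace.subspace_is_vs[OF vec_vs] assms unfolding linear_code_def by auto
  have "finite (carrier ?M)" using linear_code_finite[OF assms] by simp
  \<comment> \<open>The finite carrier spans itself, which gives finite dimension and hence a finite
    basis.\<close>
  moreover have "LinearCombinations.module.span class_ring ?M (carrier ?M) = carrier ?M"
    using W.in_own_span[of "carrier ?M"] W.span_is_subset2[of "carrier ?M"] by blast
  ultimately have "W.fin_dim" unfolding W.fin_dim_def by blast
  then obtain B where B: "finite B" "W.basis B" using W.finite_basis_exists by blast
  then have BU: "B \<subseteq> carrier ?M" unfolding W.basis_def by auto
  \<comment> \<open>Restricting the coefficients to extensional functions on \<open>B\<close> makes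
    them unique, so that \<open>card_PiE\<close> can count them.\<close>
  have ex1: "\<forall>v\<in>U. \<exists>!a. a \<in> B \<rightarrow>\<^sub>E UNIV \<and> W.lincomb a B = v"
    using W.basis_criterion[OF B(1) BU] B(2) by (auto simp: class_ring_simps)
  have closed: "W.lincomb a B \<in> U" for a
    using W.lincomb_closed[OF BU, of a] by (simp add: class_ring_simps)
  have "bij_betw (\<lambda>a. W.lincomb a B) (B \<rightarrow>\<^sub>E UNIV) U"
  proof (rule bij_betw_imageI)
    show "inj_on (\<lambda>a. W.lincomb a B) (B \<rightarrow>\<^sub>E UNIV)"
      using ex1 closed by (intro inj_onI) metis
    show "(\<lambda>a. W.lincomb a B) ` (B \<rightarrow>\<^sub>E UNIV) = U"
      using ex1 closed by blast
  qed
  then have "card U = card (B \<rightarrow>\<^sub>E (UNIV :: 'a set))" by (metis bij_betw_same_card)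
  also have "\<dots> = CARD('a) ^ card B" using B(1) by (simp add: card_PiE)
  also have "card B = vdim n U" unfolding vdim_def using W.dim_basis[OF B] by simp
  finally show ?thesis .
qed

lemma vdim_le_iff_card_le:
  fixes U :: "'a::{field,finite} vec set"
  assumes "linear_code n U"
  shows "vdim n U \<le> k \<longleftrightarrow> card U \<le> CARD('a) ^ k"
  unfolding card_linear_code[OF assms] using card_field_gt_1[where ?'a='a]
  by (simp add: power_increasing_iff)

lemma vdim_carrier: "vdim n (carrier_vec n :: 'a::field vec set) = n"
  using vec_space.dim_is_n[where ?'a='a and n=n] unfolding vdim_def
  by (simp add: module_vec_def)

lemma card_carrier_vec: "card (carrier_vec n :: 'a::{field,finite} vec set) = CARD('a) ^ n"
  using card_linear_code[OF linear_code_carrier] by (simp add: vdim_carrier)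

section \<open>Column spaces, kernels and rank-nullity by counting\<close>

definition mat_range :: "'a::semiring_0 mat \<Rightarrow> 'a vec set" where
  "mat_range A = (\<lambda>z. A *\<^sub>v z) ` carrier_vec (dim_col A)"

lemma mat_range_iff:
  "A \<in> carrier_mat N n \<Longrightarrow> v \<in> mat_range A \<longleftrightarrow> (\<exists>z\<in>carrier_vec n. v = A *\<^sub>v z)"
  unfolding mat_range_def by auto

lemma mat_range_carrier: "A \<in> carrier_mat N n \<Longrightarrow> mat_range A \<subseteq> carrier_vec N"
  unfolding mat_range_def by auto

lemma card_mat_range_le:
  fixes A :: "'a::{field,finite} mat"
  assumes "A \<in> carrier_mat N n"
  shows "card (mat_range A) \<le> CARD('a) ^ n"
  using assms card_image_le[OF finite_carrier_vec] unfolding mat_range_def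
  by (metis card_carrier_vec carrier_matD(2))

lemma linear_code_mat_range:
  assumes A: "A \<in> carrier_mat N n"
  shows "linear_code N (mat_range A)"
  unfolding linear_code_iff
proof (intro conjI ballI allI)
  show "mat_range A \<subseteq> carrier_vec N" using mat_range_carrier[OF A] .
  show "0\<^sub>v N \<in> mat_range A" unfolding mat_range_iff[OF A]
    by (rule bexI[of _ "0\<^sub>v n"]) (use A in auto)
  fix u assume "u \<in> mat_range A"
  then obtain x where x: "x \<in> carrier_vec n" "u = A *\<^sub>v x" unfolding mat_range_iff[OF A] by auto
  { fix v assume "v \<in> mat_range A"
    then obtain y where "y \<in> carrier_vec n" "v = A *\<^sub>v y" unfolding mat_range_iff[OF A] by auto
    then show "u + v \<in> mat_range A" unfolding mat_range_iff[OF A]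
      using x mult_add_distrib_mat_vec[OF A] by (intro bexI[of _ "x + y"]) auto }
  fix c show "c \<cdot>\<^sub>v u \<in> mat_range A" unfolding mat_range_iff[OF A]
    using x mult_mat_vec[OF A] by (intro bexI[of _ "c \<cdot>\<^sub>v x"]) auto
qed

text \<open>The rank is by definition the dimension of the span of the columns, and this span is the
  image of the multiplication map.\<close>

lemma card_mat_range:
  fixes A :: "'a::{field,finite} mat"
  assumes A: "A \<in> carrier_mat N n"
  shows "card (mat_range A) = CARD('a) ^ vec_space.rank N A"
proof -
  interpret vec_space "TYPE('a)" N .
  have "mat_range A = span (set (cols A))"
    using col_space_eq[OF A] A unfolding col_space_def mat_range_def by auto
  then have "rank A = vdim N (mat_range A)" unfolding rank_def vdim_def by simp
  then show ?thesis using card_linear_code[OF linear_code_mat_range[OF A]] by simp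
qed

lemma linear_code_mat_kernel:
  fixes A :: "'a::field mat"
  assumes A: "A \<in> carrier_mat N n"
  shows "linear_code n (mat_kernel A)"
  unfolding linear_code_iff
  using A by (auto simp: mat_kernel[OF A] mult_add_distrib_mat_vec[OF A] mult_mat_vec[OF A])

text \<open>Rank-nullity for the restriction of \<open>A\<close> to \<open>U\<close>, in
  multiplicative form: each nonempty fibre is a translate of
  \<open>U \<inter> mat_kernel A\<close>.\<close>

lemma card_linear_code_image:
  fixes A :: "'a::{field,finite} mat"
  assumes A: "A \<in> carrier_mat N n" and U: "linear_code n U"
  shows "card U = card ((\<lambda>x. A *\<^sub>v x) ` U) * card (U \<inter> mat_kernel A)"
proof -
  let ?f = "\<lambda>x. A *\<^sub>v x"
  have fib: "card {x \<in> U. ?f x = y} = card (U \<inter> mat_kernel A)" if y: "y \<in> ?f ` U" for y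
  proof -
    obtain x0 where x0: "x0 \<in> U" "y = ?f x0" using y by blast
    have c0: "x0 \<in> carrier_vec n" using linear_codeD(5)[OF U x0(1)] .
    have "bij_betw (\<lambda>k. x0 + k) (U \<inter> mat_kernel A) {x \<in> U. ?f x = y}"
    proof (rule bij_betw_byWitness[where f' = "\<lambda>x. x - x0"])
      show "\<forall>a\<in>U \<inter> mat_kernel A. x0 + a - x0 = a"
      proof
        fix a assume "a \<in> U \<inter> mat_kernel A"
        then show "x0 + a - x0 = a" using c0 linear_codeD(5)[OF U, of a] by (intro eq_vecI) auto
      qed
      show "\<forall>a'\<in>{x \<in> U. ?f x = y}. x0 + (a' - x0) = a'"
      proof
        fix a assume "a \<in> {x \<in> U. ?f x = y}"
        then show "x0 + (a - x0) = a" using c0 linear_codeD(5)[OF U, of a] by (intro eq_vecI) auto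
      qed
      show "(\<lambda>k. x0 + k) ` (U \<inter> mat_kernel A) \<subseteq> {x \<in> U. ?f x = y}"
        using x0 c0 linear_codeD(3)[OF U] A
        by (auto simp: mat_kernel[OF A] mult_add_distrib_mat_vec[OF A])
      show "(\<lambda>x. x - x0) ` {x \<in> U. ?f x = y} \<subseteq> U \<inter> mat_kernel A"
        using x0 c0 linear_code_diff[OF U] linear_codeD(5)[OF U] A
        by (auto simp: mat_kernel[OF A] mult_minus_distrib_mat_vec[OF A])
    qed
    then show ?thesis by (simp add: bij_betw_same_card)
  qed
  \<comment> \<open>Sorting the elements of \<open>U\<close> by their image gives a sum of fibre
    sizes, all of them equal by \<open>fib\<close>.\<close>
  have "card U = (\<Sum>y\<in>?f ` U. card {x \<in> U. ?f x = y})"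
    using sum.image_gen[OF linear_code_finite[OF U], of "\<lambda>_. 1::nat" ?f] by simp
  also have "\<dots> = card (?f ` U) * card (U \<inter> mat_kernel A)" using fib by simp
  finally show ?thesis .
qed

lemma card_mat_range_times_mat_kernel:
  fixes A :: "'a::{field,finite} mat"
  assumes A: "A \<in> carrier_mat N n"
  shows "card (mat_range A) * card (mat_kernel A) = CARD('a) ^ n"
proof -
  have "carrier_vec n \<inter> mat_kernel A = mat_kernel A" using A by (auto simp: mat_kernel[OF A])
  then show ?thesis
    using card_linear_code_image[OF A linear_code_carrier] A
    by (simp add: mat_range_def card_carrier_vec)
qed

section \<open>The Frobenius map and Galois descent\<close>

text \<open>Multiplication by \<open>x \<noteq> 0\<close> permutes the nonzero elements. Comparing
  their product before and after shows that \<open>x\<close> to the number of nonzero elements is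
  \<open>1\<close>.\<close>

lemma power_card_eq_same:
  fixes x :: "'a::{field,finite}"
  shows "x ^ CARD('a) = x"
proof (cases "x = 0")
  case True
  then show ?thesis using card_field_gt_1[where ?'a='a] by (simp add: power_0_left)
next
  case False
  let ?S = "UNIV - {0 :: 'a}"
  have "bij_betw (\<lambda>y. x * y) ?S ?S"
    by (rule bij_betw_byWitness[where f' = "\<lambda>y. inverse x * y"]) (use False in auto)
  then have "prod (\<lambda>y. x * y) ?S = \<Prod>?S" by (rule prod.reindex_bij_betw)
  then have "x ^ card ?S * \<Prod>?S = \<Prod>?S" by (simp add: prod.distrib)
  moreover have "\<Prod>?S \<noteq> 0" by simp
  ultimately have "x ^ card ?S = 1" by simp
  moreover have "CARD('a) = Suc (card ?S)"
    using card_field_gt_1[where ?'a='a] by (simp add: card_Diff_singleton)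
  ultimately show ?thesis by (metis mult.right_neutral power_Suc)
qed

locale finite_field_extension = field_hom emb
  for emb :: "'f::{field,finite} \<Rightarrow> 'a::{field,finite}" +
  fixes q :: nat
  assumes q: "q = CARD('f)"
begin

lemma q_gt_1: "q > 1" using card_field_gt_1[where ?'a='f] by (simp add: q)

abbreviation frob :: "'a \<Rightarrow> 'a" where "frob x \<equiv> x ^ q"

lemma card_range_emb: "card (range emb) = q"
  by (simp add: card_image inj_f q)

lemma frob_emb: "frob (emb c) = emb c"
  by (metis hom_power power_card_eq_same q)

text \<open>A nonzero \<open>p\<close> would have the \<open>q\<close> elements of
  \<open>range emb\<close> as roots, more than its degree allows.\<close>

lemma poly_eq_0I:
  fixes p :: "'a poly"
  assumes "\<And>c. poly p (emb c) = 0" and "degree p < q"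
  shows "p = 0"
proof (rule ccontr)
  assume "p \<noteq> 0"
  have "card (range emb) \<le> card {x. poly p x = 0}"
    by (rule card_mono) (use assms(1) in auto)
  also have "\<dots> \<le> degree p" using \<open>p \<noteq> 0\<close> by (rule card_poly_roots_bound)
  finally show False using assms(2) card_range_emb by simp
qed

text \<open>The difference of both sides is a polynomial in \<open>x\<close> of degree less than \<open>q\<close> with the \<open>q\<close>
  elements of \<open>F_q\<close> as roots. Using this twice gives additivity of the Frobenius map without
  knowing that \<open>q\<close> is a power of the characteristic.\<close>

lemma frob_add_if_emb:
  assumes "\<And>c. frob (emb c + y) = emb c + frob y"
  shows "frob (x + y) = frob x + frob y"
proof -
  let ?p = "[:y, 1:] ^ q - monom 1 q - [:frob y:]"
  have q0: "q > 0" using q_gt_1 by simp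
  have "degree ?p \<le> q"
    by (intro degree_diff_le) (simp_all add: degree_linear_power degree_monom_le)
  \<comment> \<open>The two monic terms of degree \<open>q\<close> cancel, and \<open>q > 0\<close>
    keeps the constant \<open>frob y\<close> out of this coefficient.\<close>
  moreover have "coeff ?p q = 0" 
    using q0 by (simp add: coeff_linear_power coeff_pCons split: nat.split)
  ultimately have "degree ?p < q"
    using q0 by (metis degree_0 le_neq_implies_less leading_coeff_0_iff)
  moreover have ev: "poly ?p z = frob (z + y) - frob z - frob y" for z
    by (simp add: poly_power poly_monom add.commute)
  ultimately have "?p = 0"
    by (intro poly_eq_0I) (simp_all only: ev assms frob_emb, simp)
  then have "poly ?p x = 0" by (metis poly_0)
  then show ?thesis unfolding ev by (simp add: algebra_simps)
qed

lemma frob_add: "frob (x + y) = frob x + frob y"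
proof -
  \<comment> \<open>First use, with an embedded second summand: there the premise only involves
    fixed points of \<open>frob\<close>. The result is then the premise of the second use, for
    arbitrary \<open>y\<close>.\<close>
  have "frob (x + emb c) = frob x + emb c" for x c
    using frob_add_if_emb[of "emb c" x] by (simp add: frob_emb flip: hom_add)
  then show ?thesis by (intro frob_add_if_emb) (metis add.commute)
qed

text \<open>The fixed points are the roots of a polynomial of degree \<open>q\<close>, so there are
  at most \<open>q\<close>; the elements of \<open>range emb\<close> already account for that
  many.\<close>

lemma frob_fixed_iff: "frob x = x \<longleftrightarrow> x \<in> range emb"
proof
  assume x: "frob x = x"
  let ?p = "monom 1 q - [:0, 1:] :: 'a poly"
  have "coeff ?p q = 1" using q_gt_1 by (simp add: coeff_pCons split: nat.split)
  then have p0: "?p \<noteq> 0" by (metis coeff_0 zero_neq_one)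
  have "degree ?p \<le> q"
    using q_gt_1 by (intro degree_diff_le) (simp_all add: degree_monom_le)
  then have "card {z. poly ?p z = 0} \<le> card (range emb)"
    using card_poly_roots_bound[OF p0] card_range_emb by simp
  moreover have "range emb \<subseteq> {z. poly ?p z = 0}" by (auto simp: poly_monom frob_emb)
  ultimately have "range emb = {z. poly ?p z = 0}" by (intro card_seteq) auto
  then show "x \<in> range emb" using x by (simp add: poly_monom)
qed (auto simp: frob_emb)

text \<open>Makes the transfer rules of field homomorphisms for \<open>map_vec\<close> and
  \<open>map_mat\<close> available for the Frobenius map, as they are for
  \<open>emb\<close>.\<close>

lemma field_hom_frob: "field_hom frob"
  by unfold_locales
    (use q_gt_1 in \<open>auto simp: frob_add power_mult_distrib power_0_left\<close>)

sublocale frob: field_hom frob by (rule field_hom_frob)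

text \<open>Hence the Frobenius map commutes with multiplication by an embedded matrix, the source
  of the Frobenius stability of kernels, column spaces and preimages below.\<close>

lemma frob_map_mat_emb: "map_mat frob (map_mat emb A) = map_mat emb A"
  by (rule eq_matI) (auto simp: frob_emb)

text \<open>Closure is enough: the entrywise Frobenius map is injective, so its image of the finite
  set \<open>V\<close> has as many elements as \<open>V\<close>.\<close>

lemma Gamma_spaces_iff:
  "V \<in> Gamma_spaces q n \<longleftrightarrow> linear_code n V \<and> (\<forall>v\<in>V. map_vec frob v \<in> V)"
proof (intro iffI conjI)
  assume V: "linear_code n V \<and> (\<forall>v\<in>V. map_vec frob v \<in> V)"
  then have "frobenius_image q V \<subseteq> V" unfolding frobenius_image_def by auto
  moreover have "card (frobenius_image q V) = card V"
    unfolding frobenius_image_def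
    by (intro card_image inj_onI) (use frob.vec_hom_inj in blast)
  ultimately have "frobenius_image q V = V"
    using V linear_code_finite by (intro card_subset_eq) auto
  then show "V \<in> Gamma_spaces q n" using V unfolding Gamma_spaces_def by simp
qed (auto simp: Gamma_spaces_def frobenius_image_def)

end

section \<open>Column spaces built up one column at a time\<close>

lemma mat_of_cols_Cons_mult_vCons:
  fixes w :: "'a::comm_semiring_0 vec"
  assumes "w \<in> carrier_vec n" "z \<in> carrier_vec (length ws)"
  shows "mat_of_cols n (w # ws) *\<^sub>v vCons a z = a \<cdot>\<^sub>v w + mat_of_cols n ws *\<^sub>v z"
proof (rule eq_vecI)
  fix i assume "i < dim_vec (a \<cdot>\<^sub>v w + mat_of_cols n ws *\<^sub>v z)"
  then have i: "i < n" using assms by simp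
  have "row (mat_of_cols n (w # ws)) i = vCons (w $ i) (row (mat_of_cols n ws) i)"
    using i by (auto simp: row_def vec_Suc mat_of_cols_Cons_index_0 mat_of_cols_Cons_index_Suc)
  then show "(mat_of_cols n (w # ws) *\<^sub>v vCons a z) $ i = (a \<cdot>\<^sub>v w + mat_of_cols n ws *\<^sub>v z) $ i"
    using i assms by (simp add: mult.commute)
qed (use assms in simp)

text \<open>Matches the recursion of the descent, which splits off one vector over
  \<open>F_q\<close> at each step.\<close>

lemma mat_range_mat_of_cols_Cons:
  fixes w :: "'a::comm_semiring_0 vec"
  assumes "w \<in> carrier_vec n"
  shows "mat_range (mat_of_cols n (w # ws)) =
    {a \<cdot>\<^sub>v w + v |a v. v \<in> mat_range (mat_of_cols n ws)}" (is "?L = ?R")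
proof
  show "?L \<subseteq> ?R"
  proof
    fix v assume "v \<in> ?L"
    then obtain z where z: "z \<in> carrier_vec (Suc (length ws))"
      "v = mat_of_cols n (w # ws) *\<^sub>v z" unfolding mat_range_def by auto
    have "z = vCons (z $ 0) (vec (length ws) (\<lambda>i. z $ Suc i))"
      using z(1) by (intro eq_vecI) (auto simp: vec_index_vCons)
    then have "v = z $ 0 \<cdot>\<^sub>v w + mat_of_cols n ws *\<^sub>v vec (length ws) (\<lambda>i. z $ Suc i)"
      unfolding z(2) using mat_of_cols_Cons_mult_vCons[OF assms] by (metis vec_carrier)
    moreover have "mat_of_cols n ws *\<^sub>v vec (length ws) (\<lambda>i. z $ Suc i) \<in> mat_range (mat_of_cols n ws)"
      unfolding mat_range_def by (intro imageI) simp
    ultimately show "v \<in> ?R" by blast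
  qed
  show "?R \<subseteq> ?L"
  proof
    fix v assume "v \<in> ?R"
    then obtain a z where z: "z \<in> carrier_vec (length ws)"
      "v = a \<cdot>\<^sub>v w + mat_of_cols n ws *\<^sub>v z" unfolding mat_range_def by auto
    then have "v = mat_of_cols n (w # ws) *\<^sub>v vCons a z"
      by (simp add: mat_of_cols_Cons_mult_vCons[OF assms])
    then show "v \<in> ?L" unfolding mat_range_def
      by (rule image_eqI) (use z in \<open>auto intro!: carrier_vecI\<close>)
  qed
qed

context finite_field_extension
begin

text \<open>Scale \<open>v\<close> to have an entry \<open>1\<close>. Then \<open>v\<^sup>q - v\<close> lies in \<open>V\<close> and has smaller support, so either it
  vanishes, and \<open>v\<close> has entries in \<open>F_q\<close>, or the induction continues with it.\<close>

lemma ex_frob_fixed_vec: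
  assumes V: "V \<in> Gamma_spaces q n" and v: "v \<in> V" "v \<noteq> 0\<^sub>v n"
  shows "\<exists>u\<in>carrier_vec n. u \<noteq> 0\<^sub>v n \<and> map_vec emb u \<in> V"
  using v
proof (induction "card {i. i < n \<and> v $ i \<noteq> 0}" arbitrary: v rule: less_induct)
  case less
  have LV: "linear_code n V" and frobV: "\<And>x. x \<in> V \<Longrightarrow> map_vec frob x \<in> V"
    using V unfolding Gamma_spaces_iff by auto
  have vc: "v \<in> carrier_vec n" using linear_codeD(5)[OF LV less(2)] .
  obtain j where j: "j < n" "v $ j \<noteq> 0" using less(3) vc by (auto simp: vec_eq_iff)
  define w where "w = inverse (v $ j) \<cdot>\<^sub>v v"
  have w: "w \<in> V" "w \<in> carrier_vec n" "w $ j = 1" "\<And>i. i < n \<Longrightarrow> w $ i = 0 \<longleftrightarrow> v $ i = 0"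
    unfolding w_def using j vc linear_codeD(4)[OF LV less(2)] by auto
  define u where "u = map_vec frob w - w"
  have uV: "u \<in> V" unfolding u_def using linear_code_diff[OF LV frobV] w(1) by auto
  have ui: "\<And>i. i < n \<Longrightarrow> u $ i = frob (w $ i) - w $ i" unfolding u_def using w(2) by auto
  show ?case
  proof (cases "u = 0\<^sub>v n")
    case True
    then have "frob (w $ i) = w $ i" if "i < n" for i using ui[OF that] that by simp
    then have "\<forall>i. \<exists>c. i < n \<longrightarrow> w $ i = emb c" unfolding frob_fixed_iff by (metis imageE)
    then obtain c where c: "\<And>i. i < n \<Longrightarrow> w $ i = emb (c i)" by metis
    have eq: "map_vec emb (vec n c) = w" using c w(2) by (intro eq_vecI) auto
    have "vec n c \<noteq> 0\<^sub>v n" using eq w(3) j(1) by (metis vec_hom_zero index_zero_vec(1) zero_neq_one)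
    then show ?thesis using eq w(1) by (intro bexI[of _ "vec n c"]) auto
  next
    case False
    \<comment> \<open>Zero entries of \<open>w\<close> stay zero, and at \<open>j\<close>, where
      \<open>w\<close> has entry \<open>1\<close>, the new vector vanishes while \<open>v\<close>
      does not.\<close>
    have "{i. i < n \<and> u $ i \<noteq> 0} \<subset> {i. i < n \<and> v $ i \<noteq> 0}"
    proof
      show "{i. i < n \<and> u $ i \<noteq> 0} \<subseteq> {i. i < n \<and> v $ i \<noteq> 0}"
        using w(4) ui frob.hom_zero by fastforce
      show "{i. i < n \<and> u $ i \<noteq> 0} \<noteq> {i. i < n \<and> v $ i \<noteq> 0}"
        using j ui[OF j(1)] w(3) by auto
    qed
    then have "card {i. i < n \<and> u $ i \<noteq> 0} < card {i. i < n \<and> v $ i \<noteq> 0}"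
      by (intro psubset_card_mono) auto
    then show ?thesis using less(1) uV False by blast
  qed
qed

text \<open>Galois descent by induction on the dimension: split off a nonzero vector over
  \<open>F_q\<close> and continue with the part of \<open>V\<close> that vanishes at one coordinate
  of its support.\<close>

lemma Gamma_space_eq_mat_range:
  assumes "V \<in> Gamma_spaces q n"
  shows "\<exists>B\<in>carrier_mat n (vdim n V). V = mat_range (map_mat emb B)"
proof -
  \<comment> \<open>The induction only carries an upper bound for the number of columns; a count at
    the end turns it into equality.\<close>
  have "\<exists>bs. set bs \<subseteq> carrier_vec n \<and> length bs \<le> vdim n V \<and>
    V = mat_range (mat_of_cols n (map (map_vec emb) bs))" using assms
  proof (induction "vdim n V" arbitrary: V rule: less_induct)
    case less
    have LV: "linear_code n V" and frobV: "\<And>x. x \<in> V \<Longrightarrow> map_vec frob x \<in> V"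
      using less(2) unfolding Gamma_spaces_iff by auto
    show ?case
    proof (cases "V = {0\<^sub>v n}")
      case True
      have "mat_range (mat_of_cols n ([] :: 'a vec list)) = {0\<^sub>v n}"
      proof -
        have "mat_of_cols n ([] :: 'a vec list) *\<^sub>v z = 0\<^sub>v n" if "z \<in> carrier_vec 0" for z
          using that by (intro eq_vecI) (simp_all add: scalar_prod_def)
        then have "mat_range (mat_of_cols n ([] :: 'a vec list)) =
            (\<lambda>_. 0\<^sub>v n) ` (carrier_vec 0 :: 'a vec set)"
          unfolding mat_range_def by (intro image_cong) simp_all
        then show ?thesis using image_constant[of "0\<^sub>v 0" "carrier_vec 0"] by simp
      qed
      then show ?thesis using True by (intro exI[of _ "[]"]) simp
    next
      case False
      then obtain v where "v \<in> V" "v \<noteq> 0\<^sub>v n" using linear_codeD(2)[OF LV] by auto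
      then obtain u where u: "u \<in> carrier_vec n" "u \<noteq> 0\<^sub>v n" "map_vec emb u \<in> V"
        using ex_frob_fixed_vec[OF less(2)] by blast
      let ?u = "map_vec emb u"
      obtain j where j: "j < n" "u $ j \<noteq> 0" using u(1,2) by (auto simp: vec_eq_iff)
      then have uj: "?u $ j \<noteq> 0" using u(1) by simp
      \<comment> \<open>A complement in \<open>V\<close> of the line through \<open>?u\<close>. It
        is again Frobenius stable, since a zero entry stays zero under the Frobenius map.\<close>
      define W where "W = {v \<in> V. v $ j = 0}"
      have LW: "linear_code n W"
        unfolding linear_code_iff W_def
      proof (intro conjI ballI allI)
        show "{v \<in> V. v $ j = 0} \<subseteq> carrier_vec n" using linear_codeD(1)[OF LV] by auto
        show "0\<^sub>v n \<in> {v \<in> V. v $ j = 0}" using linear_codeD(2)[OF LV] j by simp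
        fix x assume x: "x \<in> {v \<in> V. v $ j = 0}"
        { fix y assume "y \<in> {v \<in> V. v $ j = 0}"
          then show "x + y \<in> {v \<in> V. v $ j = 0}"
            using x linear_codeD(3)[OF LV] linear_codeD(5)[OF LV, of x] linear_codeD(5)[OF LV, of y] j
            by auto }
        fix c show "c \<cdot>\<^sub>v x \<in> {v \<in> V. v $ j = 0}"
          using x linear_codeD(4)[OF LV] linear_codeD(5)[OF LV, of x] j by auto
      qed
      moreover have "map_vec frob x \<in> W" if "x \<in> W" for x
        using that frobV linear_codeD(5)[OF LV, of x] j unfolding W_def by auto
      ultimately have GW: "W \<in> Gamma_spaces q n" unfolding Gamma_spaces_iff by blast
      have "W \<subset> V" using uj u(3) unfolding W_def by auto
      then have "card W < card V" by (intro psubset_card_mono linear_code_finite[OF LV])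
      then have dim: "vdim n W < vdim n V"
        unfolding card_linear_code[OF LV] card_linear_code[OF LW]
        using card_field_gt_1[where ?'a='a] by simp
      obtain bs where bs: "set bs \<subseteq> carrier_vec n" "length bs \<le> vdim n W"
        "W = mat_range (mat_of_cols n (map (map_vec emb) bs))"
        using less(1)[OF dim GW] by blast
      have "V = {a \<cdot>\<^sub>v ?u + v |a v. v \<in> W}"
      proof
        show "{a \<cdot>\<^sub>v ?u + v |a v. v \<in> W} \<subseteq> V"
          using linear_codeD(3,4)[OF LV] u(3) unfolding W_def by auto
        show "V \<subseteq> {a \<cdot>\<^sub>v ?u + v |a v. v \<in> W}"
        proof
          fix x assume x: "x \<in> V"
          \<comment> \<open>Chosen to clear the entry \<open>j\<close> of \<open>x\<close>, so that
            the remainder falls into \<open>W\<close>.\<close>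
          define a where "a = x $ j / ?u $ j"
          have xc: "x \<in> carrier_vec n" using linear_codeD(5)[OF LV x] .
          have "x - a \<cdot>\<^sub>v ?u \<in> V" using linear_code_diff[OF LV x] linear_codeD(4)[OF LV u(3)] .
          moreover have "(x - a \<cdot>\<^sub>v ?u) $ j = 0" unfolding a_def using uj j xc u(1) by simp
          ultimately have "x - a \<cdot>\<^sub>v ?u \<in> W" unfolding W_def by simp
          moreover have "x = a \<cdot>\<^sub>v ?u + (x - a \<cdot>\<^sub>v ?u)" using xc u(1) by (intro eq_vecI) auto
          ultimately show "x \<in> {a \<cdot>\<^sub>v ?u + v |a v. v \<in> W}" by blast
        qed
      qed
      then have "V = mat_range (mat_of_cols n (map (map_vec emb) (u # bs)))"
        unfolding bs(3) using mat_range_mat_of_cols_Cons[of ?u n] u(1) by simp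
      then show ?thesis using bs(1,2) dim u(1) by (intro exI[of _ "u # bs"]) simp
    qed
  qed
  then obtain bs where bs: "set bs \<subseteq> carrier_vec n" "length bs \<le> vdim n V"
    "V = mat_range (mat_of_cols n (map (map_vec emb) bs))" by blast
  have LV: "linear_code n V" using assms unfolding Gamma_spaces_iff by blast
  \<comment> \<open>Fewer than \<open>vdim n V\<close> columns could not produce all elements of
    \<open>V\<close>.\<close>
  have "card V \<le> CARD('a) ^ length bs"
    using card_mat_range_le[of "mat_of_cols n (map (map_vec emb) bs)" n "length bs"] bs(3)
    by (simp add: carrier_matI)
  then have len: "length bs = vdim n V" using vdim_le_iff_card_le[OF LV, of "length bs"] bs(2) by simp
  have "map_mat emb (mat_of_cols n bs) = mat_of_cols n (map (map_vec emb) bs)"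
    using bs(1) by (intro eq_matI) (auto simp: mat_of_cols_index subset_iff)
  then show ?thesis using bs(3) len
    by (intro bexI[of _ "mat_of_cols n bs"]) (simp_all add: carrier_matI)
qed

end

section \<open>Ranks over the small and the large field\<close>

text \<open>Descent for the trivial extension: over \<open>F_q\<close> itself every subspace is Frobenius stable.\<close>

lemma linear_code_eq_mat_range:
  fixes V :: "'a::{field,finite} vec set"
  assumes "linear_code n V"
  shows "\<exists>B\<in>carrier_mat n (vdim n V). V = mat_range B"
proof -
  interpret finite_field_extension "\<lambda>x::'a. x" "CARD('a)" by unfold_locales simp_all
  have id: "map_vec (\<lambda>x. x ^ CARD('a)) v = v" for v :: "'a vec"
    by (intro eq_vecI) (simp_all add: power_card_eq_same)
  have "map_mat (\<lambda>x. x) B = B" for B :: "'a mat" by (intro eq_matI) simp_all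
  moreover have "V \<in> Gamma_spaces CARD('a) n" unfolding Gamma_spaces_iff id using assms by simp
  ultimately show ?thesis using Gamma_space_eq_mat_range by metis
qed

text \<open>Rank factorization: with the columns of \<open>P\<close> generating the column space,
  \<open>M = P * R\<close>, where \<open>R\<close> has only \<open>?r\<close> rows. The range of the
  transpose of \<open>M\<close> then lies in that of the transpose of \<open>R\<close>, which has
  \<open>?r\<close> columns.\<close>

lemma card_mat_range_transpose_le:
  fixes M :: "'a::{field,finite} mat"
  assumes M: "M \<in> carrier_mat N n"
  shows "card (mat_range (transpose_mat M)) \<le> card (mat_range M)"
proof -
  let ?r = "vdim N (mat_range M)"
  obtain P where P: "P \<in> carrier_mat N ?r" "mat_range M = mat_range P"
    using linear_code_eq_mat_range[OF linear_code_mat_range[OF M]] by blast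
  have "\<exists>z\<in>carrier_vec ?r. col M j = P *\<^sub>v z" if j: "j < n" for j
  proof -
    have "col M j = M *\<^sub>v unit_vec n j" using M j by (intro eq_vecI) simp_all
    then have "col M j \<in> mat_range M" unfolding mat_range_iff[OF M] using unit_vec_carrier by blast
    then show ?thesis unfolding P(2) mat_range_iff[OF P(1)] .
  qed
  then obtain z where z: "\<And>j. j < n \<Longrightarrow> z j \<in> carrier_vec ?r \<and> col M j = P *\<^sub>v z j" by metis
  define R where "R = mat_of_cols ?r (map z [0..<n])"
  have R: "R \<in> carrier_mat ?r n" unfolding R_def by (simp add: carrier_matI)
  have "M = P * R"
  proof (rule mat_col_eqI)
    fix j assume "j < dim_col (P * R)"
    then have j: "j < n" using R by simp
    then have "col R j = z j" unfolding R_def using z[OF j] by (subst col_mat_of_cols) simp_all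
    then show "col M j = col (P * R) j" using col_mult2[OF P(1) R j] z[OF j] by simp
  qed (use P(1) M R in auto)
  then have MT: "transpose_mat M = transpose_mat R * transpose_mat P"
    using transpose_mult[OF P(1) R] by simp
  have "mat_range (transpose_mat M) \<subseteq> mat_range (transpose_mat R)"
  proof
    fix v assume "v \<in> mat_range (transpose_mat M)"
    then obtain y where y: "y \<in> carrier_vec N" "v = transpose_mat M *\<^sub>v y"
      using mat_range_iff[of "transpose_mat M" n N] M by auto
    then have "v = transpose_mat R *\<^sub>v (transpose_mat P *\<^sub>v y)"
      unfolding y(2) MT using P(1) R y(1) by (intro assoc_mult_mat_vec) auto
    moreover have "transpose_mat P *\<^sub>v y \<in> carrier_vec ?r" using P(1) y(1) by (intro mult_mat_vec_carrier) auto
    ultimately show "v \<in> mat_range (transpose_mat R)"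
      using mat_range_iff[of "transpose_mat R" n ?r] R by auto
  qed
  moreover have RT: "transpose_mat R \<in> carrier_mat n ?r" using R by simp
  ultimately have "card (mat_range (transpose_mat M)) \<le> card (mat_range (transpose_mat R))"
    using linear_code_finite[OF linear_code_mat_range] by (intro card_mono) blast+
  also have "\<dots> \<le> CARD('a) ^ ?r" using card_mat_range_le[OF RT] .
  also have "\<dots> = card (mat_range M)" using card_linear_code[OF linear_code_mat_range[OF M]] by simp
  finally show ?thesis .
qed

lemma rank_transpose:
  fixes M :: "'a::{field,finite} mat"
  assumes M: "M \<in> carrier_mat N n"
  shows "vec_space.rank n (transpose_mat M) = vec_space.rank N M"
proof -
  have MT: "transpose_mat M \<in> carrier_mat n N" using M by simp
  have "card (mat_range (transpose_mat M)) = card (mat_range M)"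
    using card_mat_range_transpose_le[OF M] card_mat_range_transpose_le[OF MT] by simp
  then show ?thesis
    unfolding card_mat_range[OF M] card_mat_range[OF MT]
    using card_field_gt_1[where ?'a='a] by simp
qed

text \<open>An image as large as the finite domain forces injectivity. This takes the place of
  linear independence of the columns.\<close>

lemma inj_on_mult_mat_vec:
  fixes B :: "'a::{field,finite} mat"
  assumes B: "B \<in> carrier_mat n k" and card: "card (mat_range B) = CARD('a) ^ k"
  shows "inj_on (\<lambda>z. B *\<^sub>v z) (carrier_vec k)"
proof (rule eq_card_imp_inj_on[OF finite_carrier_vec])
  show "card ((\<lambda>z. B *\<^sub>v z) ` carrier_vec k) = card (carrier_vec k :: 'a vec set)"
    using card B by (simp add: mat_range_def card_carrier_vec)
qed

text \<open>The rows of \<open>A\<close> are as many basis vectors of the kernel of \<open>B\<^sup>T\<close> as fit, padded with zero rows.\<close>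

lemma ex_annihilating_mat:
  fixes B :: "'a::{field,finite} mat"
  assumes B: "B \<in> carrier_mat n r" and N: "n - r \<le> N"
  shows "\<exists>A\<in>carrier_mat N n. n - r \<le> vec_space.rank N A \<and> A * B = 0\<^sub>m N r"
proof -
  let ?BT = "transpose_mat B"
  have BT: "?BT \<in> carrier_mat r n" using B by simp
  let ?K = "mat_kernel ?BT"
  let ?k = "vdim n ?K"
  have LK: "linear_code n ?K" by (rule linear_code_mat_kernel[OF BT])
  have "card (mat_range ?BT) \<le> CARD('a) ^ r"
    using card_mono[OF finite_carrier_vec mat_range_carrier[OF BT]] by (simp add: card_carrier_vec)
  \<comment> \<open>Rank-nullity for the transpose, whose range lives in dimension \<open>r\<close>,
    bounds the kernel from below.\<close>
  then have "CARD('a) ^ n \<le> CARD('a) ^ r * CARD('a) ^ ?k"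
    unfolding card_mat_range_times_mat_kernel[OF BT, symmetric] card_linear_code[OF LK]
    by (rule mult_right_mono) simp
  then have k: "n - r \<le> ?k"
    using card_field_gt_1[where ?'a='a] by (simp flip: power_add)
  obtain C where C: "C \<in> carrier_mat n ?k" "?K = mat_range C"
    using linear_code_eq_mat_range[OF LK] by blast
  have injC: "inj_on (\<lambda>z. C *\<^sub>v z) (carrier_vec ?k)"
    using card_linear_code[OF LK] by (intro inj_on_mult_mat_vec[OF C(1)]) (simp only: C(2)[symmetric])
  \<comment> \<open>A rectangular identity: \<open>C * E\<close> keeps the first columns of
    \<open>C\<close> and appends zero columns if \<open>N > ?k\<close>.\<close>
  define E :: "'a mat" where "E = mat ?k N (\<lambda>(i, j). if i = j then 1 else 0)"
  have E: "E \<in> carrier_mat ?k N" unfolding E_def by simp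
  define M where "M = C * E"
  have M: "M \<in> carrier_mat n N" unfolding M_def using C(1) E by simp
  \<comment> \<open>Every column of \<open>M\<close> lies in the kernel; after transposition this is
    \<open>A * B = 0\<close> for \<open>A = transpose_mat M\<close>.\<close>
  have "?BT * M = 0\<^sub>m r N"
  proof (rule mat_col_eqI)
    fix j assume "j < dim_col (0\<^sub>m r N)"
    then have j: "j < N" by simp
    have "C *\<^sub>v col E j \<in> mat_range C" unfolding mat_range_iff[OF C(1)]
      using E by (intro bexI[of _ "col E j"]) (auto intro: carrier_vecI)
    then have "C *\<^sub>v col E j \<in> ?K" by (simp only: C(2))
    then have "?BT *\<^sub>v col M j = 0\<^sub>v r"
      unfolding M_def using col_mult2[OF C(1) E j] mat_kernel[OF BT] by auto
    then show "col (?BT * M) j = col (0\<^sub>m r N) j" using col_mult2[OF BT M j] j by simp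
  qed (use BT M in auto)
  moreover have "transpose_mat (0\<^sub>m r N) = (0\<^sub>m N r :: 'a mat)" by (intro eq_matI) simp_all
  ultimately have "transpose_mat M * B = 0\<^sub>m N r"
    using transpose_mult[OF BT M] by simp
  moreover have "n - r \<le> vec_space.rank N (transpose_mat M)"
  proof -
    \<comment> \<open>Extension by zero from length \<open>n - r\<close>. As \<open>n - r\<close>
      exceeds neither \<open>N\<close> nor \<open>?k\<close>, \<open>E\<close> merely changes the
      length of such vectors, so \<open>M\<close> acts on them like the injective \<open>C\<close>;
      this gives rank at least \<open>n - r\<close>.\<close>
    define pad where "pad m z = vec m (\<lambda>i. if i < n - r then z $ i else 0 :: 'a)" for m z
    have Epad: "E *\<^sub>v pad N z = pad ?k z" for z
      unfolding E_def pad_def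
      by (intro eq_vecI) (use k N in \<open>auto simp: scalar_prod_def if_distrib[of "\<lambda>x. x * _"] sum.delta cong: if_cong\<close>)
    have "inj_on (\<lambda>z. M *\<^sub>v pad N z) (carrier_vec (n - r))"
    proof (rule inj_onI)
      fix x y :: "'a vec"
      assume xy: "x \<in> carrier_vec (n - r)" "y \<in> carrier_vec (n - r)"
        and eq: "M *\<^sub>v pad N x = M *\<^sub>v pad N y"
      have "M *\<^sub>v pad N z = C *\<^sub>v pad ?k z" for z
        unfolding M_def Epad[symmetric] by (rule assoc_mult_mat_vec[OF C(1) E]) (simp add: pad_def)
      then have "C *\<^sub>v pad ?k x = C *\<^sub>v pad ?k y" using eq by simp
      then have eq': "pad ?k x = pad ?k y" by (rule inj_onD[OF injC]) (simp_all add: pad_def)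
      have "x $ i = y $ i" if "i < n - r" for i
        using arg_cong[OF eq', of "\<lambda>v. v $ i"] that k by (simp add: pad_def)
      then show "x = y" using xy by (intro eq_vecI) auto
    qed
    moreover have "(\<lambda>z. M *\<^sub>v pad N z) ` carrier_vec (n - r) \<subseteq> mat_range M"
      using M unfolding mat_range_def pad_def by auto
    ultimately have "CARD('a) ^ (n - r) \<le> card (mat_range M)"
      using card_inj_on_le[OF _ _ linear_code_finite[OF linear_code_mat_range[OF M]]]
      by (metis card_carrier_vec)
    then have "n - r \<le> vec_space.rank n M"
      unfolding card_mat_range[OF M] using card_field_gt_1[where ?'a='a]
      by (simp add: power_increasing_iff)
    then show ?thesis using rank_transpose[OF M] by simp
  qed
  ultimately show ?thesis using M by (intro bexI[of _ "transpose_mat M"]) simp_all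
qed

section \<open>Confusable vectors and Frobenius stable spaces of small dimension\<close>

context finite_field_extension
begin

text \<open>Cut the columns of \<open>B\<close> and the entries of \<open>z\<close> into blocks of
  lengths \<open>a\<close> and \<open>b\<close>, filling up with zeros when
  \<open>k < a + b\<close>.\<close>

lemma mult_mat_vec_split:
  assumes B: "B \<in> carrier_mat n k" and k: "k \<le> a + b" and z: "z \<in> carrier_vec k"
  shows "\<exists>P\<in>carrier_mat n a. \<exists>Q\<in>carrier_mat n b. \<exists>x\<in>carrier_vec a. \<exists>y\<in>carrier_vec b.
    map_mat emb B *\<^sub>v z = map_mat emb P *\<^sub>v x + map_mat emb Q *\<^sub>v y"
proof (intro bexI)
  let ?P = "mat n a (\<lambda>(i, c). if c < k then B $$ (i, c) else 0)"
  let ?Q = "mat n b (\<lambda>(i, c). if a + c < k then B $$ (i, a + c) else 0)"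
  let ?x = "vec a (\<lambda>c. if c < k then z $ c else 0)"
  let ?y = "vec b (\<lambda>c. if a + c < k then z $ (a + c) else 0)"
  show "map_mat emb B *\<^sub>v z = map_mat emb ?P *\<^sub>v ?x + map_mat emb ?Q *\<^sub>v ?y"
  proof (rule eq_vecI)
    fix i assume "i < dim_vec (map_mat emb ?P *\<^sub>v ?x + map_mat emb ?Q *\<^sub>v ?y)"
    then have i: "i < n" by simp
    \<comment> \<open>The summands of the matrix-vector product, extended by zero beyond
      \<open>k\<close> so that the sum can be cut at \<open>a\<close>.\<close>
    define f where "f c = (if c < k then emb (B $$ (i, c)) * z $ c else 0)" for c
    have "(map_mat emb B *\<^sub>v z) $ i = sum f {0..<k}"
      using i B z unfolding f_def by (auto simp: scalar_prod_def)
    also have "\<dots> = sum f {0..<a + b}"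
      by (rule sum.mono_neutral_left) (use k in \<open>auto simp: f_def\<close>)
    also have "\<dots> = sum f {0..<a} + sum f {a..<a + b}"
      by (simp add: sum.atLeastLessThan_concat)
    also have "sum f {a..<a + b} = (\<Sum>c = 0..<b. f (a + c))"
      using sum.shift_bounds_nat_ivl[of f 0 a b] by (simp add: add.commute)
    also have "sum f {0..<a} = (map_mat emb ?P *\<^sub>v ?x) $ i"
      using i by (auto simp: scalar_prod_def f_def intro!: sum.cong)
    also have "(\<Sum>c = 0..<b. f (a + c)) = (map_mat emb ?Q *\<^sub>v ?y) $ i"
      using i by (auto simp: scalar_prod_def f_def intro!: sum.cong)
    finally show "(map_mat emb B *\<^sub>v z) $ i =
      (map_mat emb ?P *\<^sub>v ?x + map_mat emb ?Q *\<^sub>v ?y) $ i" using i by simp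
  qed (use B in simp)
qed auto

text \<open>The basis of \<open>V\<close> over \<open>F_q\<close> is cut into blocks of widths
  \<open>\<rho>\<close>, \<open>t\<close> and \<open>t\<close>. \<open>A\<close> kills the first
  block, and the products of \<open>A\<close> with the other two are the error matrices.\<close>

lemma Gamma_space_confusable:
  assumes V: "V \<in> Gamma_spaces q n" and dim: "vdim n V \<le> 2 * t + \<rho>"
    and w: "w \<in> V" and N: "n - \<rho> \<le> N"
  shows "\<exists>A\<in>carrier_mat N n. n - \<rho> \<le> vec_space.rank N A \<and>
    (\<exists>D\<in>carrier_mat N t. \<exists>D'\<in>carrier_mat N t. \<exists>Z\<in>carrier_vec t. \<exists>Z'\<in>carrier_vec t.
      map_mat emb A *\<^sub>v w = map_mat emb D *\<^sub>v Z + map_mat emb D' *\<^sub>v Z')"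
proof -
  obtain B where B: "B \<in> carrier_mat n (vdim n V)" "V = mat_range (map_mat emb B)"
    using Gamma_space_eq_mat_range[OF V] by blast
  have "map_mat emb B \<in> carrier_mat n (vdim n V)" using B(1) by simp
  from mat_range_iff[OF this] obtain z where z: "z \<in> carrier_vec (vdim n V)"
    "w = map_mat emb B *\<^sub>v z" using w B(2) by blast
  have "vdim n V \<le> \<rho> + (t + t)" using dim by simp
  from mult_mat_vec_split[OF B(1) this z(1)] obtain P Q x y where
    P: "P \<in> carrier_mat n \<rho>" and Q: "Q \<in> carrier_mat n (t + t)" and
    x: "x \<in> carrier_vec \<rho>" and y: "y \<in> carrier_vec (t + t)" and
    w1: "w = map_mat emb P *\<^sub>v x + map_mat emb Q *\<^sub>v y"
    unfolding z(2) by blast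
  from mult_mat_vec_split[OF Q order_refl y] obtain D D' Z Z' where
    D: "D \<in> carrier_mat n t" "D' \<in> carrier_mat n t" and
    Z: "Z \<in> carrier_vec t" "Z' \<in> carrier_vec t" and
    w2: "map_mat emb Q *\<^sub>v y = map_mat emb D *\<^sub>v Z + map_mat emb D' *\<^sub>v Z'" by blast
  obtain A where A: "A \<in> carrier_mat N n" "n - \<rho> \<le> vec_space.rank N A" "A * P = 0\<^sub>m N \<rho>"
    using ex_annihilating_mat[OF P N] by blast
  have A': "map_mat emb A \<in> carrier_mat N n" using A(1) by simp
  have assoc: "map_mat emb A *\<^sub>v (map_mat emb M *\<^sub>v v) = map_mat emb (A * M) *\<^sub>v v"
    if "M \<in> carrier_mat n m" "v \<in> carrier_vec m" for M m v
    unfolding mat_hom_mult[OF A(1) that(1)]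
    by (rule assoc_mult_mat_vec[symmetric, OF A' _ that(2)]) (use that(1) in simp)
  have "map_mat emb (A * P) *\<^sub>v x = 0\<^sub>v N"
    unfolding A(3) using x by (intro eq_vecI) (simp_all add: scalar_prod_def)
  then have Px: "map_mat emb A *\<^sub>v (map_mat emb P *\<^sub>v x) = 0\<^sub>v N" using assoc[OF P x] by simp
  have c: "map_mat emb D *\<^sub>v Z \<in> carrier_vec n" "map_mat emb D' *\<^sub>v Z' \<in> carrier_vec n"
    "map_mat emb P *\<^sub>v x \<in> carrier_vec n" using D P by (auto intro!: carrier_vecI)
  have "map_mat emb A *\<^sub>v w = 0\<^sub>v N + (map_mat emb (A * D) *\<^sub>v Z + map_mat emb (A * D') *\<^sub>v Z')"
    unfolding w1 w2 using c Px assoc[OF D(1) Z(1)] assoc[OF D(2) Z(2)]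
    by (simp add: mult_add_distrib_mat_vec[OF A'])
  also have "\<dots> = map_mat emb (A * D) *\<^sub>v Z + map_mat emb (A * D') *\<^sub>v Z'"
    using A(1) by (intro left_zero_vec carrier_vecI) simp
  finally show ?thesis using A D Z mult_carrier_mat[OF A(1)] by blast
qed

lemma Gamma_spaces_mat_kernel:
  assumes A: "A \<in> carrier_mat N n"
  shows "mat_kernel (map_mat emb A) \<in> Gamma_spaces q n"
proof -
  have A': "map_mat emb A \<in> carrier_mat N n" using A by simp
  have "map_vec frob v \<in> mat_kernel (map_mat emb A)" if "v \<in> mat_kernel (map_mat emb A)" for v
    using that frob.mult_mat_vec_hom[OF A', of v] frob.vec_hom_zero[of N]
    unfolding frob_map_mat_emb mat_kernel[OF A'] by auto
  then show ?thesis unfolding Gamma_spaces_iff using linear_code_mat_kernel[OF A'] by blast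
qed

text \<open>The kernel does not grow in dimension under field extension: being Frobenius stable, it
  has a basis over \<open>F_q\<close>, whose combinations over \<open>F_q\<close> already lie in the
  kernel of \<open>A\<close>. Rank-nullity over \<open>F_q\<close> then gives the bound.\<close>

lemma vdim_mat_kernel_map_mat_le:
  assumes A: "A \<in> carrier_mat N n"
  shows "vdim n (mat_kernel (map_mat emb A)) + vec_space.rank N A \<le> n"
proof -
  let ?K = "mat_kernel (map_mat emb A)"
  let ?k = "vdim n ?K"
  have A': "map_mat emb A \<in> carrier_mat N n" using A by simp
  obtain B where B: "B \<in> carrier_mat n ?k" "?K = mat_range (map_mat emb B)"
    using Gamma_space_eq_mat_range[OF Gamma_spaces_mat_kernel[OF A]] by blast
  have B': "map_mat emb B \<in> carrier_mat n ?k" using B(1) by simp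
  have inj: "inj_on (\<lambda>z. map_mat emb B *\<^sub>v z) (carrier_vec ?k)"
    using card_linear_code[OF linear_code_mat_kernel[OF A']]
    by (intro inj_on_mult_mat_vec[OF B']) (simp only: B(2)[symmetric])
  \<comment> \<open>Injectivity descends to \<open>F_q\<close> because \<open>emb\<close> is itself
    injective.\<close>
  have injB: "inj_on (\<lambda>z. B *\<^sub>v z) (carrier_vec ?k)"
  proof (rule inj_onI)
    fix x y assume xy: "x \<in> carrier_vec ?k" "y \<in> carrier_vec ?k" "B *\<^sub>v x = B *\<^sub>v y"
    then have "map_mat emb B *\<^sub>v map_vec emb x = map_mat emb B *\<^sub>v map_vec emb y"
      using mult_mat_vec_hom[OF B(1)] by metis
    then have "map_vec emb x = map_vec emb y" by (rule inj_onD[OF inj]) (use xy in auto)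
    then show "x = y" by (rule vec_hom_inj)
  qed
  have "(\<lambda>z. B *\<^sub>v z) ` carrier_vec ?k \<subseteq> mat_kernel A"
  proof
    fix v assume "v \<in> (\<lambda>z. B *\<^sub>v z) ` carrier_vec ?k"
    then obtain z where z: "z \<in> carrier_vec ?k" "v = B *\<^sub>v z" by blast
    have vc: "v \<in> carrier_vec n" using z B(1) by auto
    have "map_vec emb v \<in> mat_range (map_mat emb B)" unfolding mat_range_iff[OF B'] z(2)
      using mult_mat_vec_hom[OF B(1) z(1)] z(1) by (intro bexI[of _ "map_vec emb z"]) simp_all
    then have "map_vec emb v \<in> ?K" by (simp only: B(2)[symmetric])
    then have "map_vec emb (A *\<^sub>v v) = 0\<^sub>v N"
      using mult_mat_vec_hom[OF A vc] mat_kernel[OF A'] by auto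
    then show "v \<in> mat_kernel A" using vc mat_kernel[OF A] by simp
  qed
  then have "CARD('f) ^ ?k \<le> card (mat_kernel A)"
    using card_inj_on_le[OF injB _ linear_code_finite[OF linear_code_mat_kernel[OF A]]]
    by (simp add: card_carrier_vec)
  then have "CARD('f) ^ vec_space.rank N A * CARD('f) ^ ?k \<le> CARD('f) ^ n"
    unfolding card_mat_range_times_mat_kernel[OF A, symmetric] card_mat_range[OF A] by simp
  then show ?thesis using card_field_gt_1[where ?'a='f]
    by (simp add: power_increasing_iff flip: power_add)
qed

end

lemma linear_code_preimage:
  fixes A :: "'a::field mat"
  assumes A: "A \<in> carrier_mat N n" and U: "linear_code N U"
  shows "linear_code n {v \<in> carrier_vec n. A *\<^sub>v v \<in> U}"
proof -
  have "A *\<^sub>v 0\<^sub>v n = 0\<^sub>v N" using A by (intro eq_vecI) auto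
  then show ?thesis
    unfolding linear_code_iff using linear_codeD[OF U]
    by (auto simp: mult_add_distrib_mat_vec[OF A] mult_mat_vec[OF A])
qed

lemma linear_code_sum:
  fixes U V :: "'a::field vec set"
  assumes U: "linear_code n U" and V: "linear_code n V"
  shows "linear_code n {u + v |u v. u \<in> U \<and> v \<in> V}"
  unfolding linear_code_iff
proof (intro conjI ballI allI)
  let ?S = "{u + v |u v. u \<in> U \<and> v \<in> V}"
  show "?S \<subseteq> carrier_vec n" using linear_codeD(5)[OF U] linear_codeD(5)[OF V] by auto
  have "0\<^sub>v n = 0\<^sub>v n + (0\<^sub>v n :: 'a vec)" by simp
  then show "0\<^sub>v n \<in> ?S" using linear_codeD(2)[OF U] linear_codeD(2)[OF V] by blast
  fix x assume "x \<in> ?S"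
  then obtain u v where x: "x = u + v" "u \<in> U" "v \<in> V" by blast
  have xc: "u \<in> carrier_vec n" "v \<in> carrier_vec n"
    using linear_codeD(5)[OF U x(2)] linear_codeD(5)[OF V x(3)] .
  { fix y assume "y \<in> ?S"
    then obtain u' v' where y: "y = u' + v'" "u' \<in> U" "v' \<in> V" by blast
    have "u' \<in> carrier_vec n" "v' \<in> carrier_vec n"
      using linear_codeD(5)[OF U y(2)] linear_codeD(5)[OF V y(3)] .
    then have "x + y = (u + u') + (v + v')" unfolding x(1) y(1) using xc by (intro eq_vecI) auto
    then show "x + y \<in> ?S"
      using linear_codeD(3)[OF U x(2) y(2)] linear_codeD(3)[OF V x(3) y(3)] by blast }
  fix c
  have "c \<cdot>\<^sub>v x = c \<cdot>\<^sub>v u + c \<cdot>\<^sub>v v" unfolding x(1) using xc by (rule smult_add_distrib_vec)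
  then show "c \<cdot>\<^sub>v x \<in> ?S"
    using linear_codeD(4)[OF U x(2)] linear_codeD(4)[OF V x(3)] by blast
qed

context finite_field_extension
begin

text \<open>The witness is the preimage under \<open>A\<close> of the sum of the two error column
  spaces. Its image has dimension at most \<open>2 * t\<close>, and the kernel of \<open>A\<close>
  contributes at most \<open>\<rho>\<close>.\<close>

lemma confusable_in_Gamma_space:
  assumes A: "A \<in> carrier_mat N n" "n - \<rho> \<le> vec_space.rank N A" and w: "w \<in> carrier_vec n"
    and D: "D \<in> carrier_mat N t" "D' \<in> carrier_mat N t"
    and Z: "Z \<in> carrier_vec t" "Z' \<in> carrier_vec t"
    and eq: "map_mat emb A *\<^sub>v w = map_mat emb D *\<^sub>v Z + map_mat emb D' *\<^sub>v Z'"
  shows "\<exists>V\<in>Gamma_spaces q n. vdim n V \<le> 2 * t + \<rho> \<and> w \<in> V"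
proof -
  let ?A = "map_mat emb A" and ?D = "map_mat emb D" and ?D' = "map_mat emb D'"
  have A': "?A \<in> carrier_mat N n" and D': "?D \<in> carrier_mat N t" "?D' \<in> carrier_mat N t"
    using A D by auto
  define R where "R = {u + v |u v. u \<in> mat_range ?D \<and> v \<in> mat_range ?D'}"
  have LR: "linear_code N R" unfolding R_def
    by (rule linear_code_sum[OF linear_code_mat_range[OF D'(1)] linear_code_mat_range[OF D'(2)]])
  have frob_range: "map_vec frob u \<in> mat_range (map_mat emb M)"
    if M: "M \<in> carrier_mat N t" and u: "u \<in> mat_range (map_mat emb M)" for u M
  proof -
    have M': "map_mat emb M \<in> carrier_mat N t" using M by simp
    obtain z where z: "z \<in> carrier_vec t" "u = map_mat emb M *\<^sub>v z"
      using u unfolding mat_range_iff[OF M'] by blast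
    then have "map_vec frob u = map_mat emb M *\<^sub>v map_vec frob z"
      using frob.mult_mat_vec_hom[OF M' z(1)] unfolding frob_map_mat_emb by simp
    then show ?thesis unfolding mat_range_iff[OF M'] using z(1) by auto
  qed
  have frobR: "map_vec frob u \<in> R" if u: "u \<in> R" for u
  proof -
    obtain a b where ab: "u = a + b" "a \<in> mat_range ?D" "b \<in> mat_range ?D'"
      using u unfolding R_def by blast
    have "map_vec frob u = map_vec frob a + map_vec frob b"
      unfolding ab(1) using subsetD[OF mat_range_carrier ab(2), OF D'(1)]
        subsetD[OF mat_range_carrier ab(3), OF D'(2)]
      by (intro eq_vecI) (auto simp: frob_add)
    then show ?thesis unfolding R_def using frob_range[OF D(1) ab(2)] frob_range[OF D(2) ab(3)] by blast
  qed
  \<comment> \<open>Addition maps the product of the two ranges onto \<open>R\<close>, and each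
    range has at most \<open>CARD('a) ^ t\<close> elements.\<close>
  have "R = (\<lambda>(u, v). u + v) ` (mat_range ?D \<times> mat_range ?D')" unfolding R_def by auto
  then have "card R \<le> card (mat_range ?D) * card (mat_range ?D')"
    using linear_code_finite[OF linear_code_mat_range[OF D'(1)]]
      linear_code_finite[OF linear_code_mat_range[OF D'(2)]]
    by (metis card_cartesian_product card_image_le finite_cartesian_product)
  also have "\<dots> \<le> CARD('a) ^ t * CARD('a) ^ t"
    using card_mat_range_le[OF D'(1)] card_mat_range_le[OF D'(2)] by (rule mult_mono) auto
  finally have cR: "card R \<le> CARD('a) ^ (2 * t)" by (simp add: mult_2 power_add)
  define V where "V = {v \<in> carrier_vec n. ?A *\<^sub>v v \<in> R}"
  have LV: "linear_code n V" unfolding V_def by (rule linear_code_preimage[OF A' LR])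
  have "map_vec frob v \<in> V" if v: "v \<in> V" for v
  proof -
    have "v \<in> carrier_vec n" "?A *\<^sub>v v \<in> R" using v unfolding V_def by auto
    then show ?thesis
      using frobR[of "?A *\<^sub>v v"] frob.mult_mat_vec_hom[OF A', of v]
      unfolding V_def frob_map_mat_emb by simp
  qed
  then have GV: "V \<in> Gamma_spaces q n" unfolding Gamma_spaces_iff using LV by blast
  let ?k = "vdim n (mat_kernel ?A)"
  have "?k \<le> \<rho>" using vdim_mat_kernel_map_mat_le[OF A(1)] A(2) by simp
  moreover have "card (V \<inter> mat_kernel ?A) \<le> CARD('a) ^ ?k"
    unfolding card_linear_code[OF linear_code_mat_kernel[OF A'], symmetric]
    by (intro card_mono linear_code_finite[OF linear_code_mat_kernel[OF A']]) auto
  ultimately have "card (V \<inter> mat_kernel ?A) \<le> CARD('a) ^ \<rho>"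
    using card_field_gt_1[where ?'a='a] by (meson le_trans less_imp_le power_increasing)
  moreover have "card ((\<lambda>x. ?A *\<^sub>v x) ` V) \<le> CARD('a) ^ (2 * t)"
    using card_mono[OF linear_code_finite[OF LR], of "(\<lambda>x. ?A *\<^sub>v x) ` V"] cR
    unfolding V_def by fastforce
  ultimately have "card V \<le> CARD('a) ^ (2 * t) * CARD('a) ^ \<rho>"
    unfolding card_linear_code_image[OF A' LV] by (intro mult_mono) auto
  then have "vdim n V \<le> 2 * t + \<rho>" unfolding vdim_le_iff_card_le[OF LV] power_add .
  moreover have "w \<in> V"
    unfolding V_def R_def using w eq mat_range_iff[OF D'(1)] mat_range_iff[OF D'(2)] Z by blast
  ultimately show ?thesis using GV by blast
qed

end

section \<open>Nested coset coding\<close>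

text \<open>Since \<open>C2 \<inter> V\<close> lies in \<open>C1 \<inter> V\<close>, the dimensions
  differ exactly when the sets do.\<close>

lemma vdim_Int_less_iff:
  fixes C1 C2 V :: "'a::{field,finite} vec set"
  assumes C1: "linear_code n C1" and C2: "linear_code n C2" and sub: "C2 \<subseteq> C1"
    and V: "linear_code n V"
  shows "vdim n (C2 \<inter> V) < vdim n (C1 \<inter> V) \<longleftrightarrow> (\<exists>w\<in>V. w \<in> C1 - C2)"
proof
  assume "vdim n (C2 \<inter> V) < vdim n (C1 \<inter> V)"
  then have "C2 \<inter> V \<noteq> C1 \<inter> V" by auto
  then show "\<exists>w\<in>V. w \<in> C1 - C2" using sub by blast
next
  assume "\<exists>w\<in>V. w \<in> C1 - C2"
  then have "C2 \<inter> V \<subset> C1 \<inter> V" using sub by blast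
  then have "card (C2 \<inter> V) < card (C1 \<inter> V)"
    by (intro psubset_card_mono linear_code_finite[OF linear_code_Int[OF C1 V]])
  then show "vdim n (C2 \<inter> V) < vdim n (C1 \<inter> V)"
    unfolding card_linear_code[OF linear_code_Int[OF C1 V]]
      card_linear_code[OF linear_code_Int[OF C2 V]]
    using card_field_gt_1[where ?'a='a] by simp
qed

lemma carrier_quotient_space:
  "carrier (quotient_space n C1 C2) = (\<lambda>x. (\<lambda>c. c + x) ` C2) ` C1"
  unfolding quotient_space_def
  by (auto simp: A_RCOSETS_def' a_r_coset_def' module_vec_simps)

text \<open>Were \<open>X - X'\<close> in \<open>C2\<close>, the representatives of the two cosets
  would differ by an element of \<open>C2\<close>, so the cosets would coincide, against the
  injectivity of \<psi>.\<close>

lemma coset_diff: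
  assumes C1: "linear_code n C1" and C2: "linear_code n C2" and sub: "C2 \<subseteq> C1"
    and \<psi>: "bij_betw \<psi> (carrier_vec l) (carrier (quotient_space n C1 C2))"
    and S: "S \<in> carrier_vec l" "S' \<in> carrier_vec l" "S \<noteq> S'" and X: "X \<in> \<psi> S" "X' \<in> \<psi> S'"
  shows "X - X' \<in> C1 - C2" "X \<in> C1" "X' \<in> C1"
proof -
  have "\<psi> S \<in> carrier (quotient_space n C1 C2)" "\<psi> S' \<in> carrier (quotient_space n C1 C2)"
    using bij_betwE[OF \<psi>] S by auto
  then obtain x x' where x: "x \<in> C1" "\<psi> S = (\<lambda>c. c + x) ` C2"
    and x': "x' \<in> C1" "\<psi> S' = (\<lambda>c. c + x') ` C2"
    unfolding carrier_quotient_space by blast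
  obtain c where c: "c \<in> C2" "X = c + x" using X(1) unfolding x(2) by blast
  obtain c' where c': "c' \<in> C2" "X' = c' + x'" using X(2) unfolding x'(2) by blast
  show XX: "X \<in> C1" "X' \<in> C1"
    unfolding c(2) c'(2) using c(1) c'(1) x(1) x'(1) sub linear_codeD(3)[OF C1] by auto
  have carr: "x \<in> carrier_vec n" "x' \<in> carrier_vec n" "c \<in> carrier_vec n" "c' \<in> carrier_vec n"
    using linear_codeD(5)[OF C1] linear_codeD(5)[OF C2] x(1) x'(1) c(1) c'(1) by auto
  have "X - X' \<notin> C2"
  proof
    assume d: "X - X' \<in> C2"
    have "(X - X') - c + c' \<in> C2"
      using linear_codeD(3)[OF C2 linear_code_diff[OF C2 d c(1)] c'(1)] .
    moreover have "(X - X') - c + c' = x - x'"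
      unfolding c(2) c'(2) using carr by (intro eq_vecI) auto
    ultimately have e: "x - x' \<in> C2" by simp
    have "\<psi> S = \<psi> S'" unfolding x(2) x'(2)
    proof (intro equalityI subsetI)
      fix v assume "v \<in> (\<lambda>c. c + x) ` C2"
      then obtain b where b: "b \<in> C2" "v = b + x" by blast
      then have "v = (b + (x - x')) + x'" using carr linear_codeD(5)[OF C2 b(1)] by (intro eq_vecI) auto
      then show "v \<in> (\<lambda>c. c + x') ` C2" using linear_codeD(3)[OF C2 b(1) e] by blast
    next
      fix v assume "v \<in> (\<lambda>c. c + x') ` C2"
      then obtain b where b: "b \<in> C2" "v = b + x'" by blast
      then have "v = (b - (x - x')) + x" using carr linear_codeD(5)[OF C2 b(1)] by (intro eq_vecI) auto
      then show "v \<in> (\<lambda>c. c + x) ` C2" using linear_code_diff[OF C2 b(1) e] by blast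
    qed
    then show False using \<psi> S unfolding bij_betw_def inj_on_def by blast
  qed
  then show "X - X' \<in> C1 - C2" using linear_code_diff[OF C1 XX] by simp
qed

text \<open>Surjectivity of \<psi> yields messages for the coset of \<open>w\<close> and for
  \<open>C2\<close> itself. They differ because \<open>w\<close> is not in
  \<open>C2\<close>.\<close>

lemma ex_cosets:
  assumes C1: "linear_code n C1" and C2: "linear_code n C2"
    and \<psi>: "bij_betw \<psi> (carrier_vec l) (carrier (quotient_space n C1 C2))"
    and w: "w \<in> C1 - C2"
  shows "\<exists>S\<in>carrier_vec l. \<exists>S'\<in>carrier_vec l. S \<noteq> S' \<and> w \<in> \<psi> S \<and> 0\<^sub>v n \<in> \<psi> S'"
proof -
  have "(\<lambda>c. c + w) ` C2 \<in> carrier (quotient_space n C1 C2)"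
    "(\<lambda>c. c + 0\<^sub>v n) ` C2 \<in> carrier (quotient_space n C1 C2)"
    unfolding carrier_quotient_space using w linear_codeD(2)[OF C1] by blast+
  then obtain S S' where S: "S \<in> carrier_vec l" "\<psi> S = (\<lambda>c. c + w) ` C2"
    and S': "S' \<in> carrier_vec l" "\<psi> S' = (\<lambda>c. c + 0\<^sub>v n) ` C2"
    using \<psi> unfolding bij_betw_def by (metis imageE)
  have id: "(\<lambda>c. c + 0\<^sub>v n) ` C2 = C2" using linear_codeD(5)[OF C2] by force
  have "0\<^sub>v n + w = w" using w linear_codeD(5)[OF C1] by auto
  then have wS: "w \<in> \<psi> S" unfolding S(2) using linear_codeD(2)[OF C2] by (metis image_eqI)
  moreover have "w \<notin> \<psi> S'" unfolding S'(2) id using w by blast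
  moreover have "0\<^sub>v n \<in> \<psi> S'" unfolding S'(2) id by (rule linear_codeD(2)[OF C2])
  ultimately show ?thesis using S(1) S'(1) by metis
qed

text \<open>The minimum ranges over a finite set, and the whole space, which contains all of
  \<open>C1 - C2\<close>, makes it nonempty. So it exceeds \<open>k\<close> exactly when no
  admissible \<open>V\<close> has dimension at most \<open>k\<close>.\<close>

lemma M_R1_gt_iff:
  fixes C1 C2 :: "'a::{field,finite} vec set"
  assumes C1: "linear_code n C1" and C2: "linear_code n C2" and sub: "C2 \<subset> C1"
    and carrier: "carrier_vec n \<in> (Gamma_spaces q n :: 'a vec set set)"
  shows "k < M_R1 q n C1 C2 \<longleftrightarrow>
    \<not> (\<exists>V\<in>Gamma_spaces q n. vdim n V \<le> k \<and> (\<exists>w\<in>V. w \<in> C1 - C2))"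
proof -
  let ?T = "{vdim n V | V. V \<in> Gamma_spaces q n \<and>
    int (vdim n (C1 \<inter> V)) - int (vdim n (C2 \<inter> V)) \<ge> 1}"
  have "int (vdim n (C1 \<inter> V)) - int (vdim n (C2 \<inter> V)) \<ge> 1 \<longleftrightarrow> (\<exists>w\<in>V. w \<in> C1 - C2)"
    if "V \<in> Gamma_spaces q n" for V
    using vdim_Int_less_iff[OF C1 C2, of V] sub that unfolding Gamma_spaces_def by auto
  then have T: "?T = {vdim n V | V. V \<in> Gamma_spaces q n \<and> (\<exists>w\<in>V. w \<in> C1 - C2)}" by blast
  have "(Gamma_spaces q n :: 'a vec set set) \<subseteq> Pow (carrier_vec n)"
    unfolding Gamma_spaces_def using linear_codeD(1) by blast
  then have "finite (Gamma_spaces q n :: 'a vec set set)"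
    using finite_carrier_vec by (meson finite_Pow_iff finite_subset)
  then have fin: "finite ?T" unfolding T by simp
  have "\<exists>w\<in>carrier_vec n. w \<in> C1 - C2" using sub linear_codeD(1)[OF C1] by blast
  then have ne: "?T \<noteq> {}" unfolding T using carrier by blast
  show ?thesis unfolding M_R1_def Min_gr_iff[OF fin ne] unfolding T by (auto simp: not_le)
qed

theorem theorem38:
  fixes emb :: "'f::{field,finite} \<Rightarrow> 'a::{field,finite}"
    and C1 C2 :: "'a vec set"
    and \<psi> :: "'a vec \<Rightarrow> 'a vec set"
    and m n l N t \<rho> :: nat
  assumes "field_extension_of_degree emb m" and "m \<ge> 1"
    and "linear_code n C1" and "linear_code n C2" and "C2 \<subset> C1"
    and "int (vdim n C2) = int (vdim n C1) - int l" and "l \<ge> 1"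
    and "linear_bijection l n C1 C2 \<psi>"
    and "\<rho> \<le> n" and "N \<ge> n - \<rho>"
  shows "universally_correcting emb N n l \<psi> t \<rho> \<longleftrightarrow> M_R1 (card (UNIV :: 'f set)) n C1 C2 > 2 * t + \<rho>"
proof -
  note C1 = assms(3) and C2 = assms(4)
  interpret field_hom emb using assms(1) unfolding field_extension_of_degree_def by simp
  interpret finite_field_extension emb "CARD('f)" by unfold_locales simp
  have \<psi>: "bij_betw \<psi> (carrier_vec l) (carrier (quotient_space n C1 C2))"
    using assms(8) unfolding linear_bijection_def by simp
  have "(carrier_vec n :: 'a vec set) \<in> Gamma_spaces CARD('f) n"
    unfolding Gamma_spaces_iff by (auto intro: linear_code_carrier)
  note M = M_R1_gt_iff[OF C1 C2 assms(5) this]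
  show ?thesis unfolding M
  proof
    assume uc: "universally_correcting emb N n l \<psi> t \<rho>"
    show "\<not> (\<exists>V\<in>Gamma_spaces CARD('f) n. vdim n V \<le> 2 * t + \<rho> \<and> (\<exists>w\<in>V. w \<in> C1 - C2))"
    proof
      assume "\<exists>V\<in>Gamma_spaces CARD('f) n. vdim n V \<le> 2 * t + \<rho> \<and> (\<exists>w\<in>V. w \<in> C1 - C2)"
      then obtain V w where V: "V \<in> Gamma_spaces CARD('f) n" "vdim n V \<le> 2 * t + \<rho>" "w \<in> V"
        and w: "w \<in> C1 - C2" by blast
      obtain A D D' Z Z' where A: "A \<in> carrier_mat N n" "n - \<rho> \<le> vec_space.rank N A"
        and D: "D \<in> carrier_mat N t" "D' \<in> carrier_mat N t"
        and Z: "Z \<in> carrier_vec t" "Z' \<in> carrier_vec t"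
        and eq: "map_mat emb A *\<^sub>v w = map_mat emb D *\<^sub>v Z + map_mat emb D' *\<^sub>v Z'"
        using Gamma_space_confusable[OF V assms(10)] by blast
      obtain S S' where S: "S \<in> carrier_vec l" "S' \<in> carrier_vec l" "S \<noteq> S'"
        "w \<in> \<psi> S" "0\<^sub>v n \<in> \<psi> S'"
        using ex_cosets[OF C1 C2 \<psi> w] by blast
      have wc: "w \<in> carrier_vec n" using w linear_codeD(5)[OF C1] by blast
      have mZ: "map_mat emb D *\<^sub>v (- Z) = - (map_mat emb D *\<^sub>v Z)"
        using D(1) Z(1) by (intro eq_vecI) auto
      have A0: "map_mat emb A *\<^sub>v 0\<^sub>v n = 0\<^sub>v N" using A(1) by (intro eq_vecI) auto
      \<comment> \<open>The codewords \<open>w\<close> and \<open>0\<close> collide: negating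
        \<open>Z\<close> moves the first error term to the other side, leaving \<open>D' Z'\<close>
        as the common received word.\<close>
      have "map_mat emb A *\<^sub>v w + map_mat emb D *\<^sub>v (- Z) =
        map_mat emb A *\<^sub>v 0\<^sub>v n + map_mat emb D' *\<^sub>v Z'"
        unfolding eq mZ A0 using D by (intro eq_vecI) auto
      moreover have "- Z \<in> carrier_vec t" using Z(1) by simp
      ultimately show False using uc A D Z S unfolding universally_correcting_def by blast
    qed
  next
    assume none: "\<not> (\<exists>V\<in>Gamma_spaces CARD('f) n. vdim n V \<le> 2 * t + \<rho> \<and> (\<exists>w\<in>V. w \<in> C1 - C2))"
    show "universally_correcting emb N n l \<psi> t \<rho>"
      unfolding universally_correcting_def
    proof (intro ballI impI notI, elim bexE conjE)
      fix A S S' X X' D D' Z Z'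
      assume A: "A \<in> carrier_mat N n" "n - \<rho> \<le> vec_space.rank N A"
        and S: "S \<in> carrier_vec l" "S' \<in> carrier_vec l" "S \<noteq> S'"
        and X: "X \<in> \<psi> S" "X' \<in> \<psi> S'"
        and D: "D \<in> carrier_mat N t" "D' \<in> carrier_mat N t"
        and Z: "Z \<in> carrier_vec t" "Z' \<in> carrier_vec t"
        and eq: "map_mat emb A *\<^sub>v X + map_mat emb D *\<^sub>v Z =
          map_mat emb A *\<^sub>v X' + map_mat emb D' *\<^sub>v Z'"
      note diff = coset_diff[OF C1 C2 psubset_imp_subset[OF assms(5)] \<psi> S X]
      have Xc: "X \<in> carrier_vec n" "X' \<in> carrier_vec n"
        using diff(2,3) linear_codeD(5)[OF C1] by auto
      have A': "map_mat emb A \<in> carrier_mat N n" using A(1) by simp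
      \<comment> \<open>The same sign change in reverse: subtracting the two received words leaves
        only error terms on the right.\<close>
      have "map_mat emb A *\<^sub>v (X - X') = map_mat emb D *\<^sub>v (- Z) + map_mat emb D' *\<^sub>v Z'"
        (is "?l = ?r")
      proof (rule eq_vecI)
        show "dim_vec ?l = dim_vec ?r" using A D by simp
        fix i assume "i < dim_vec ?r"
        then have i: "i < N" using D by simp
        have "map_mat emb D *\<^sub>v (- Z) = - (map_mat emb D *\<^sub>v Z)"
          using D(1) Z(1) by (intro eq_vecI) auto
        moreover have "(map_mat emb A *\<^sub>v X) $ i + (map_mat emb D *\<^sub>v Z) $ i =
          (map_mat emb A *\<^sub>v X') $ i + (map_mat emb D' *\<^sub>v Z') $ i"
          using arg_cong[OF eq, of "\<lambda>v. v $ i"] i D by (simp del: index_mult_mat_vec)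
        ultimately show "?l $ i = ?r $ i"
          unfolding mult_minus_distrib_mat_vec[OF A' Xc] using i A D
          by (simp del: index_mult_mat_vec add: algebra_simps)
      qed
      moreover have "- Z \<in> carrier_vec t" using Z(1) by simp
      moreover have "X - X' \<in> carrier_vec n" using Xc by simp
      ultimately have "\<exists>V\<in>Gamma_spaces CARD('f) n. vdim n V \<le> 2 * t + \<rho> \<and> X - X' \<in> V"
        using confusable_in_Gamma_space[OF A _ D _ Z(2)] by blast
      then show False using none diff(1) by blast
    qed
  qed
qed

end
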